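(* Let $T$ be a bounded linear operator on a complex Banach space $X$ such that $\limsup_{n\to\infty} n\,\|T^{n+1}-T^n\|<\frac1e$. Then $X$ decomposes as the direct sum of two closed $T$-invariant subspaces such that $T$ is the identity on one of these subspaces, and the spectral radius of $T$ restricted to the other subspace is strictly less than $1$. In particular, $T^n$ converges (as $n\to\infty$) to a projection.
   Context: All Banach spaces are complex. Either of the two subspaces may be $\{0\}$, the spectral condition being vacuous on $\{0\}$. A projection is a bounded idempotent operator; convergence is in operator norm. $e$ is the base of the natural logarithm. *)

theory Defs
  imports "HOL-Analysis.Analysis"
begin

text \<open>Complex Banach spaces: the real normed structure is the one underlying the
  complex one, so that the library notions \<open>subspace\<close>, \<open>closed\<close>, \<open>bounded_linear\<close> and
  \<open>onorm\<close> apply to it.\<close>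

class complex_normed_vector = real_normed_vector +
  fixes scaleC :: "complex \<Rightarrow> 'a \<Rightarrow> 'a"  (infixr "*\<^sub>C" 75)
  assumes scaleC_add_right: "c *\<^sub>C (x + y) = c *\<^sub>C x + c *\<^sub>C y"
    and scaleC_add_left: "(c + d) *\<^sub>C x = c *\<^sub>C x + d *\<^sub>C x"
    and scaleC_scaleC: "c *\<^sub>C d *\<^sub>C x = (c * d) *\<^sub>C x"
    and scaleR_scaleC: "r *\<^sub>R x = complex_of_real r *\<^sub>C x"
    and norm_scaleC: "norm (c *\<^sub>C x) = cmod c * norm x"

class complex_banach = complex_normed_vector + banach

instantiation complex :: complex_banach
begin

definition scaleC_complex :: "complex \<Rightarrow> complex \<Rightarrow> complex" where
  "scaleC_complex c x = c * x"

instance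
  by standard (simp_all add: scaleC_complex_def algebra_simps norm_mult scaleR_conv_of_real)

end

definition csubspace :: "'a::complex_normed_vector set \<Rightarrow> bool" where
  "csubspace M \<longleftrightarrow> subspace M \<and> (\<forall>c. \<forall>x\<in>M. c *\<^sub>C x \<in> M)"

definition bounded_clinear ::
    "('a::complex_normed_vector \<Rightarrow> 'b::complex_normed_vector) \<Rightarrow> bool" where
  "bounded_clinear f \<longleftrightarrow> bounded_linear f \<and> (\<forall>c x. f (c *\<^sub>C x) = c *\<^sub>C f x)"

text \<open>Bounded linear operators on the normed space \<open>Y\<close>, a subspace of the ambient type;
  values of \<open>f\<close> outside \<open>Y\<close> are irrelevant.\<close>

definition bounded_clinear_on ::
    "'a::complex_normed_vector set \<Rightarrow> ('a \<Rightarrow> 'a) \<Rightarrow> bool" where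
  "bounded_clinear_on Y f \<longleftrightarrow>
     f \<in> Y \<rightarrow> Y \<and>
     (\<forall>x\<in>Y. \<forall>y\<in>Y. f (x + y) = f x + f y) \<and>
     (\<forall>c. \<forall>x\<in>Y. f (c *\<^sub>C x) = c *\<^sub>C f x) \<and>
     (\<exists>K. \<forall>x\<in>Y. norm (f x) \<le> K * norm x)"

lemma bounded_clinear_on_UNIV: "bounded_clinear_on UNIV f \<longleftrightarrow> bounded_clinear f"
proof
  assume f: "bounded_clinear_on UNIV f"
  then obtain K where K: "\<And>x. norm (f x) \<le> K * norm x"
    unfolding bounded_clinear_on_def by auto
  have "bounded_linear f"
    using f K by (intro bounded_linear_intro[of _ K])
      (auto simp: bounded_clinear_on_def scaleR_scaleC mult.commute)
  with f show "bounded_clinear f"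
    by (simp add: bounded_clinear_def bounded_clinear_on_def)
next
  assume f: "bounded_clinear f"
  then interpret bounded_linear f by (simp add: bounded_clinear_def)
  from bounded obtain K where "\<And>x. norm (f x) \<le> norm x * K" by blast
  then show "bounded_clinear_on UNIV f"
    using f by (auto simp: bounded_clinear_on_def bounded_clinear_def add mult.commute)
qed

definition invertible_on :: "'a::complex_normed_vector set \<Rightarrow> ('a \<Rightarrow> 'a) \<Rightarrow> bool" where
  "invertible_on Y f \<longleftrightarrow>
     (\<exists>g. bounded_clinear_on Y g \<and> (\<forall>y\<in>Y. g (f y) = y \<and> f (g y) = y))"

text \<open>Spectrum and spectral radius of the restriction of \<open>S\<close> to an invariant subspace \<open>Y\<close>.
  On \<open>Y = {0}\<close> the spectrum is empty and the spectral radius, a supremum in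
  \<open>[0, \<infinity>]\<close>, is \<open>0\<close>.\<close>

definition spectrum_on :: "'a::complex_normed_vector set \<Rightarrow> ('a \<Rightarrow> 'a) \<Rightarrow> complex set" where
  "spectrum_on Y S = {c. \<not> invertible_on Y (\<lambda>x. c *\<^sub>C x - S x)}"

definition spectral_radius_on :: "'a::complex_normed_vector set \<Rightarrow> ('a \<Rightarrow> 'a) \<Rightarrow> ennreal" where
  "spectral_radius_on Y S = (SUP c\<in>spectrum_on Y S. ennreal (cmod c))"

lemma spectral_radius_on_zero:
  assumes "S 0 = 0"
  shows "spectral_radius_on {0} S = 0"
proof -
  have c0: "c *\<^sub>C (0::'a) = 0" for c
    using norm_scaleC[of c "0::'a"] by simp
  have "spectrum_on {0} S = {}"
    using assms by (auto simp: spectrum_on_def invertible_on_def bounded_clinear_on_def c0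
        intro!: exI[of _ id])
  then show ?thesis
    by (simp add: spectral_radius_on_def bot_ennreal)
qed

definition direct_sum_decomposition :: "'a::real_vector set \<Rightarrow> 'a set \<Rightarrow> bool" where
  "direct_sum_decomposition M N \<longleftrightarrow>
     M \<inter> N = {0} \<and> (\<forall>x. \<exists>m\<in>M. \<exists>n\<in>N. x = m + n)"

definition bounded_projection :: "('a::complex_normed_vector \<Rightarrow> 'a) \<Rightarrow> bool" where
  "bounded_projection P \<longleftrightarrow> bounded_clinear P \<and> P \<circ> P = P"

end

theory Submission
  imports Defs "HOL-Computational_Algebra.Polynomial"
begin

text \<open>
  Put \<open>B = I - T\<close>. The whole theorem follows once \<open>\<parallel>T\<^sup>n B\<parallel>\<close> decays geometrically: then
  \<open>T\<^sup>n\<close> converges geometrically to a projection \<open>P\<close>, the fixed space of \<open>T\<close> is the range of \<open>P\<close>,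
  and on the kernel of \<open>P\<close> the powers of \<open>T\<close> decay geometrically, which bounds the spectrum
  there by the Neumann series.

  The hypothesis gives only \<open>\<parallel>T\<^sup>n B\<parallel> \<le> L / n\<close> for large \<open>n\<close>, with \<open>e L < 1\<close>. Factoring
  \<open>T\<^sup>N B\<^sup>p\<close> into \<open>p\<close> nearly equal pieces \<open>T\<^sup>m B\<close> turns this into \<open>\<parallel>T\<^sup>N B\<^sup>p\<parallel> \<le> (L p / N)\<^sup>p\<close>, up
  to rounding. These bounds are fed into the Bezout identity for the powers of \<open>T\<close> and \<open>B\<close>,
  whose sum is \<open>I\<close> (\<open>bezout_powers\<close>): its first half is the Taylor polynomial of degree \<open>K\<close> at
  \<open>B = 0\<close> of \<open>(I - B)\<close> raised to the power \<open>-(t+1)\<close>, multiplied by \<open>T\<close> to the power \<open>t+1\<close>, and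
  the second half is the exact remainder. Multiplying it by \<open>T\<^sup>s B\<close> with \<open>s\<close> a large multiple of
  \<open>K\<close> expresses \<open>T\<^sup>s B\<close> through terms with high powers of \<open>T\<close> or of \<open>B\<close>. By Stirling's bound
  \<open>p\<^sup>p / p! \<le> e\<^sup>p\<close> the Taylor part is at most a convergent series with ratio close to \<open>e L\<close>,
  divided by \<open>t\<close>, while the remainder is at most \<open>t\<close> times a multiple of the \<open>K\<close>-th power of
  that ratio (\<open>gauge_expansion_estimate\<close>). Letting \<open>t\<close> grow exponentially in \<open>K\<close>, slowly
  enough, makes both parts exponentially small (\<open>gauge_geometric_decay\<close>).

  In this way explicit polynomials in \<open>T\<close> take the place of the Riesz projection for the
  spectral point \<open>1\<close>. As all operators
  involved are polynomials in \<open>T\<close>, the estimates are carried out in a commutative ring with a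
  submultiplicative size function and then applied to real polynomials \<open>p\<close>, measured by the
  operator norm of \<open>p(T)\<close>.
\<close>

section \<open>The Bezout identity for powers\<close>

text \<open>The recursion in \<open>K\<close> for the truncated expansions of \<open>(1 - a)\<close> to the power \<open>-(K+1)\<close>:
  multiplying by \<open>1 - a\<close> lowers the exponent, and truncation leaves one boundary term.\<close>

lemma truncated_geometric_sum:
  fixes a b :: "'b::comm_ring_1"
  assumes "a + b = 1"
  shows "b * (\<Sum>j\<le>t. of_nat ((Suc K + j) choose j) * a ^ j)
           + a ^ Suc t * of_nat ((Suc K + t) choose t)
         = (\<Sum>j\<le>t. of_nat ((K + j) choose j) * a ^ j)"
proof (induction t)
  case 0
  then show ?case using assms by (simp add: add.commute)
next
  case (Suc t)
  have b: "b = 1 - a" using assms by (simp add: algebra_simps)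
  have pascal: "(Suc K + Suc t) choose Suc t = ((K + Suc t) choose Suc t) + ((Suc K + t) choose t)"
    by simp
  have "b * (\<Sum>j\<le>Suc t. of_nat ((Suc K + j) choose j) * a ^ j)
           + a ^ Suc (Suc t) * of_nat ((Suc K + Suc t) choose Suc t)
      = (b * (\<Sum>j\<le>t. of_nat ((Suc K + j) choose j) * a ^ j)
           + a ^ Suc t * of_nat ((Suc K + t) choose t))
        + a ^ Suc t * (of_nat ((Suc K + Suc t) choose Suc t) - of_nat ((Suc K + t) choose t))"
    unfolding sum.atMost_Suc b by (simp add: algebra_simps del: binomial_Suc_Suc add_Suc add_Suc_right)
  also have "\<dots> = (\<Sum>j\<le>Suc t. of_nat ((K + j) choose j) * a ^ j)"
    unfolding Suc.IH pascal by (simp add: algebra_simps)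
  finally show ?case .
qed

text \<open>The probabilistic meaning (for real \<open>a, b\<close> in \<open>[0, 1]\<close>) explains the coefficients: in
  repeated trials with outcomes \<open>a\<close> and \<open>b\<close>, the first sum is the probability that \<open>t + 1\<close>
  outcomes \<open>a\<close> come before \<open>K + 1\<close> outcomes \<open>b\<close>, and the second is that of the opposite event.\<close>

lemma bezout_powers:
  fixes a b :: "'b::comm_ring_1"
  assumes "a + b = 1"
  shows "a ^ Suc t * (\<Sum>k\<le>K. of_nat ((t + k) choose k) * b ^ k)
       + b ^ Suc K * (\<Sum>j\<le>t. of_nat ((K + j) choose j) * a ^ j) = 1"
proof (induction K)
  case 0
  have "b = 1 - a" using assms by (simp add: algebra_simps)
  then have "1 - a ^ Suc t = b * (\<Sum>j\<le>t. a ^ j)"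
    using one_diff_power_eq[of a "Suc t"] by (simp only: lessThan_Suc_atMost)
  then show ?case by (simp add: diff_eq_eq add.commute)
next
  case (Suc K)
  have sym: "(t + Suc K) choose Suc K = (Suc K + t) choose t"
    using binomial_symmetric[of t "t + Suc K"] by (simp add: add.commute)
  show ?case
    using Suc.IH unfolding truncated_geometric_sum[OF assms, of K t, symmetric] sum.atMost_Suc sym
    by (simp add: algebra_simps)
qed

text \<open>A single term of the exponential series at \<open>p\<close> is at most its sum.\<close>

lemma power_self_le_fact_exp: "real p ^ p \<le> fact p * exp 1 ^ p"
proof -
  have "real p ^ p / fact p = (\<Sum>n\<in>{p}. inverse (fact n) * real p ^ n)"
    by (simp add: field_simps)
  also have "\<dots> \<le> exp (real p)"
    unfolding exp_def
    by (subst real_scaleR_def[symmetric], intro sum_le_suminf summable_exp_generic) auto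
  also have "exp (real p) = exp 1 ^ p"
    by (simp flip: exp_of_nat_mult)
  finally show ?thesis by (simp add: field_simps)
qed

section \<open>Decay estimates for a submultiplicative size function\<close>

text \<open>The only scalars that occur are binomial coefficients. As they are natural numbers, the
  triangle inequality takes the place of homogeneity, and the estimates can live in a plain
  commutative ring.\<close>

locale submultiplicative_gauge =
  fixes \<nu> :: "'b::comm_ring_1 \<Rightarrow> real"
  assumes nonneg: "0 \<le> \<nu> x"
    and zero: "\<nu> 0 = 0"
    and triangle: "\<nu> (x + y) \<le> \<nu> x + \<nu> y"
    and submult: "\<nu> (x * y) \<le> \<nu> x * \<nu> y"
begin

lemma gauge_of_nat_mult: "\<nu> (of_nat n * x) \<le> real n * \<nu> x"
proof (induction n)
  case (Suc n)
  have "\<nu> (of_nat (Suc n) * x) \<le> \<nu> x + \<nu> (of_nat n * x)"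
    using triangle[of x "of_nat n * x"] by (simp add: algebra_simps)
  with Suc show ?case by (simp add: algebra_simps)
qed (simp add: zero)

lemma gauge_sum: "\<nu> (\<Sum>i\<in>A. f i) \<le> (\<Sum>i\<in>A. \<nu> (f i))"
proof (induction A rule: infinite_finite_induct)
  case (insert i A)
  then show ?case using triangle[of "f i" "sum f A"] by simp
qed (simp_all add: zero)

text \<open>All factors but one are \<open>a ^ m * b\<close>; the last one takes the surplus power of \<open>a\<close>, which is
  why the decay hypothesis is needed for all exponents from \<open>m\<close> on.\<close>

lemma gauge_power_mult_power_le_piece:
  fixes m :: nat
  assumes decay: "\<And>n. m \<le> n \<Longrightarrow> \<nu> (a ^ n * b) \<le> L / m"
    and "0 < p" "m * p \<le> N"
  shows "\<nu> (a ^ N * b ^ p) \<le> (L / m) ^ p"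
  using assms(2,3)
proof (induction p arbitrary: N rule: nat_induct_non_zero)
  case 1
  then show ?case using decay[of N] by simp
next
  case (Suc p)
  have N: "N = m + (N - m)" "m * p \<le> N - m" using Suc.prems by auto
  have "a ^ N * b ^ Suc p = (a ^ m * b) * (a ^ (N - m) * b ^ p)"
    by (subst N(1), simp only: power_add power_Suc mult_ac)
  also have "\<nu> \<dots> \<le> \<nu> (a ^ m * b) * \<nu> (a ^ (N - m) * b ^ p)"
    by (rule submult)
  also have "\<dots> \<le> L / m * (L / m) ^ p"
    by (intro mult_mono decay Suc.IH N(2) nonneg order_trans[OF nonneg decay]) auto
  finally show ?case by simp
qed

text \<open>Choosing the pieces as large as possible, \<open>m = N div p\<close>, costs less than \<open>p\<close> in the exponent
  by rounding. The bound is stated for every \<open>y\<close> up to \<open>N + 1 - p\<close>, so that spare exponent can be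
  given up for a convenient denominator.\<close>

lemma gauge_power_mult_power_le:
  assumes decay: "\<And>n. n0 \<le> n \<Longrightarrow> \<nu> (a ^ n * b) \<le> L / n"
    and "0 < n0" "0 < p" "n0 * p \<le> N" "0 \<le> L"
    and y: "0 < y" "y \<le> real N + 1 - real p"
  shows "\<nu> (a ^ N * b ^ p) \<le> (L * p / y) ^ p"
proof -
  define m where "m = N div p"
  have m: "n0 \<le> m"
    using assms by (simp add: m_def less_eq_div_iff_mult_less_eq)
  have "N < p * Suc m"
    unfolding m_def using \<open>0 < p\<close> by (rule dividend_less_times_div[THEN less_le_trans]) simp
  then have "real N + 1 \<le> real (p * Suc m)" by (simp only: of_nat_Suc[symmetric] of_nat_le_iff Suc_le_eq)
  then have ym: "y \<le> real p * real m"
    using y by (simp add: algebra_simps)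
  have decay': "\<nu> (a ^ n * b) \<le> L / m" if "m \<le> n" for n
  proof -
    have "L / n \<le> L / m" using that m \<open>0 < n0\<close> \<open>0 \<le> L\<close> by (intro divide_left_mono) auto
    with decay[of n] that m show ?thesis by simp
  qed
  have "\<nu> (a ^ N * b ^ p) \<le> (L / m) ^ p"
    using decay' \<open>0 < p\<close> by (rule gauge_power_mult_power_le_piece) (auto simp: m_def)
  also have "L / m \<le> L * p / y"
    using m \<open>0 < n0\<close> \<open>0 \<le> L\<close> ym y mult_left_mono[OF ym \<open>0 \<le> L\<close>] by (simp add: field_simps)
  then have "(L / m) ^ p \<le> (L * p / y) ^ p"
    using \<open>0 \<le> L\<close> by (intro power_mono) auto
  finally show ?thesis .
qed

text \<open>The Bezout identity is multiplied by \<open>a ^ s * b\<close>. A factor \<open>a ^ s\<close> with \<open>s \<ge> 2 (K + 1)\<close>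
  compensates the rounding losses and makes \<open>K + 1 + j\<close> a valid denominator in the remainder
  terms, where it cancels against the binomial coefficients; \<open>s \<ge> n0 (K + 1)\<close> makes all pieces long
  enough for the decay hypothesis. In the Taylor part, the parameter \<open>w\<close>, slightly above \<open>1\<close>,
  pays for replacing \<open>t + k\<close> by \<open>t + 1\<close> in the binomial coefficients.\<close>

lemma gauge_expansion_estimate:
  assumes ab: "a + b = 1"
    and decay: "\<And>n. n0 \<le> n \<Longrightarrow> \<nu> (a ^ n * b) \<le> L / n"
    and n0: "0 < n0" and L: "0 \<le> L"
    and w: "1 \<le> w" "real K \<le> (w - 1) * real (Suc t)"
    and q: "exp 1 * w * L \<le> q" "q < 1"
    and s: "max 2 n0 * Suc K \<le> s"
  shows "\<nu> (a ^ s * b) \<le> 1 / (1 - q)\<^sup>2 / Suc t + \<nu> b * Suc t * q ^ Suc K"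
proof -
  have q0: "0 \<le> q" using q w L by (smt (verit) exp_ge_zero mult_nonneg_nonneg)
  have s2: "2 * Suc K \<le> s" "n0 * Suc K \<le> s"
    by (rule order_trans[OF mult_le_mono1 s]; simp)+
  have eL: "exp 1 * L \<le> q"
  proof -
    have "exp 1 * L * 1 \<le> exp 1 * L * w" using w L by (intro mult_left_mono) auto
    with q show ?thesis by (simp add: mult_ac)
  qed
  \<comment> \<open>The Taylor part; here \<open>Suc t\<close> is an admissible denominator because \<open>s\<close> exceeds \<open>k\<close>.\<close>
  have low: "\<nu> (of_nat ((t + k) choose k) * (a ^ (Suc t + s) * b ^ Suc k)) \<le> (1 / Suc t) * (Suc k * q ^ Suc k)"
    if k: "k \<le> K" for k
  proof -
    have "n0 * Suc k \<le> n0 * Suc K" using k by simp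
    then have n: "n0 * Suc k \<le> Suc t + s" using s2(2) by linarith
    have "\<nu> (a ^ (Suc t + s) * b ^ Suc k) \<le> (L * Suc k / Suc t) ^ Suc k"
      using decay n0 _ n L by (rule gauge_power_mult_power_le) (use k s2 in auto)
    moreover have "real ((t + k) choose k) \<le> (w * Suc t) ^ k / fact k"
    proof -
      have "real ((t + k) choose k) * fact k \<le> real (t + k) ^ k"
        using binomial_fact_pow[of "t + k" k] by (metis of_nat_fact of_nat_le_iff of_nat_mult of_nat_power)
      also have "\<dots> \<le> (w * Suc t) ^ k"
        using k w by (intro power_mono) (auto simp: algebra_simps)
      finally show ?thesis by (simp add: field_simps)
    qed
    ultimately have "\<nu> (of_nat ((t + k) choose k) * (a ^ (Suc t + s) * b ^ Suc k))
        \<le> (w * Suc t) ^ k / fact k * (L * Suc k / Suc t) ^ Suc k"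
      using w L by (intro order_trans[OF gauge_of_nat_mult] mult_mono) (auto intro: nonneg)
    also have "\<dots> = (1 / Suc t) * (w ^ k * L ^ Suc k * (real (Suc k) ^ Suc k / fact k))"
    proof -
      have "(w * y) ^ k / f * (L * z / y) ^ Suc k = 1 / y * (w ^ k * L ^ Suc k * (z ^ Suc k / f))"
        if "0 < y" for y z f :: real
        using that by (simp add: power_mult_distrib power_divide divide_simps)
      then show ?thesis by simp
    qed
    also have "\<dots> \<le> (1 / Suc t) * (w ^ Suc k * L ^ Suc k * (real (Suc k) * exp 1 ^ Suc k))"
    proof (intro mult_left_mono mult_mono)
      show "w ^ k \<le> w ^ Suc k" using w by (intro power_increasing) auto
      show "real (Suc k) ^ Suc k / fact k \<le> real (Suc k) * exp 1 ^ Suc k"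
        using power_self_le_fact_exp[of "Suc k"] by (simp add: field_simps fact_Suc del: power_Suc of_nat_Suc)
    qed (use w L in auto)
    also have "\<dots> = (1 / Suc t) * (Suc k * (exp 1 * w * L) ^ Suc k)"
      by (simp add: power_mult_distrib algebra_simps)
    also have "\<dots> \<le> (1 / Suc t) * (Suc k * q ^ Suc k)"
      using q w L by (intro mult_left_mono power_mono) auto
    finally show ?thesis .
  qed
  \<comment> \<open>The remainder; one factor \<open>b\<close> is set aside, so that \<open>s\<close> has to provide for only \<open>Suc K\<close> pieces.\<close>
  have high: "\<nu> (of_nat ((K + j) choose j) * (a ^ (j + s) * b ^ Suc K)) \<le> q ^ Suc K" for j
  proof -
    have "\<nu> (a ^ (j + s) * b ^ Suc K) \<le> (L * Suc K / (j + Suc K)) ^ Suc K"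
      using decay n0 _ _ L by (rule gauge_power_mult_power_le) (use s2 in auto)
    moreover have "real ((K + j) choose j) \<le> real (j + Suc K) ^ Suc K / fact (Suc K)"
    proof -
      have "(K + j) choose j = (K + j) choose K"
        using binomial_symmetric[of j "K + j"] by simp
      also have "\<dots> \<le> (j + Suc K) choose Suc K"
        by (simp add: add.commute)
      finally have "((K + j) choose j) * fact (Suc K) \<le> ((j + Suc K) choose Suc K) * fact (Suc K)"
        by (rule mult_le_mono1)
      also have "\<dots> \<le> (j + Suc K) ^ Suc K"
        by (rule binomial_fact_pow)
      finally have "real ((K + j) choose j) * fact (Suc K) \<le> real (j + Suc K) ^ Suc K"
        by (metis of_nat_fact of_nat_le_iff of_nat_mult of_nat_power)
      then show ?thesis by (simp add: field_simps del: fact_Suc power_Suc)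
    qed
    ultimately have "\<nu> (of_nat ((K + j) choose j) * (a ^ (j + s) * b ^ Suc K))
       \<le> real (j + Suc K) ^ Suc K / fact (Suc K) * (L * Suc K / (j + Suc K)) ^ Suc K"
      using L by (intro order_trans[OF gauge_of_nat_mult] mult_mono) (auto intro: nonneg)
    also have "\<dots> = L ^ Suc K * (real (Suc K) ^ Suc K / fact (Suc K))"
      by (simp add: power_mult_distrib power_divide del: power_Suc fact_Suc of_nat_Suc of_nat_add)
    also have "\<dots> \<le> L ^ Suc K * exp 1 ^ Suc K"
      using power_self_le_fact_exp[of "Suc K"] L
      by (intro mult_left_mono) (auto simp: field_simps simp del: fact_Suc power_Suc of_nat_Suc)
    also have "\<dots> = (exp 1 * L) ^ Suc K" by (simp add: power_mult_distrib mult.commute del: power_Suc)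
    also have "\<dots> \<le> q ^ Suc K" using eL L by (intro power_mono) auto
    finally show ?thesis .
  qed
  have "a ^ s * b = a ^ s * b * (a ^ Suc t * (\<Sum>k\<le>K. of_nat ((t + k) choose k) * b ^ k)
       + b ^ Suc K * (\<Sum>j\<le>t. of_nat ((K + j) choose j) * a ^ j))"
    by (simp only: bezout_powers[OF ab] mult_1_right)
  also have "\<dots> = (\<Sum>k\<le>K. of_nat ((t + k) choose k) * (a ^ (Suc t + s) * b ^ Suc k))
       + b * (\<Sum>j\<le>t. of_nat ((K + j) choose j) * (a ^ (j + s) * b ^ Suc K))"
    unfolding distrib_left sum_distrib_left
    by (intro arg_cong2[where f = "(+)"] sum.cong refl) (simp_all only: power_add power_Suc mult_ac)
  finally have expansion: "a ^ s * b = \<dots>" .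
  have "\<nu> (a ^ s * b) \<le> (\<Sum>k\<le>K. (1 / Suc t) * (Suc k * q ^ Suc k)) + \<nu> b * (\<Sum>j\<le>t. q ^ Suc K)"
    unfolding expansion
    by (intro order_trans[OF triangle] add_mono order_trans[OF submult] mult_left_mono
        order_trans[OF gauge_sum] sum_mono low high nonneg) auto
  also have "(\<Sum>k\<le>K. (1 / Suc t) * (Suc k * q ^ Suc k)) \<le> (1 / Suc t) * (1 / (1 - q)\<^sup>2)"
  proof -
    have "(\<Sum>k\<le>K. Suc k * q ^ Suc k) \<le> (\<Sum>k\<le>K. Suc k * q ^ k)"
      using q q0 by (intro sum_mono mult_left_mono) (auto intro: mult_left_le_one_le)
    also have "\<dots> \<le> 1 / (1 - q)\<^sup>2"
      using geometric_deriv_sums[of q] q q0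
      by (intro order_trans[OF sum_le_suminf[of "\<lambda>k. Suc k * q ^ k"]]) (auto simp: sums_iff)
    finally show ?thesis
      unfolding sum_distrib_left[symmetric] by (intro mult_left_mono) auto
  qed
  finally show ?thesis by (simp add: mult_ac)
qed

text \<open>The two parts of the estimate balance when \<open>t + 1\<close> is about \<open>q\<close> to the power \<open>-K/2\<close>. To keep
  to natural numbers, \<open>v\<close> is chosen with \<open>q ^ v \<le> 1/4\<close>, and then \<open>K + 1 = v u\<close> and \<open>t + 1 = 2\<^sup>u\<close>,
  so that both parts are of order \<open>2\<close> to the power \<open>-u\<close>, where \<open>u\<close> is proportional to \<open>s\<close>.\<close>

theorem gauge_geometric_decay:
  assumes ab: "a + b = 1"
    and decay: "\<forall>\<^sub>F n in sequentially. real n * \<nu> (a ^ n * b) \<le> L"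
    and L: "exp 1 * L < 1"
  obtains D \<sigma> where "0 < \<sigma>" "\<sigma> < 1" "\<And>n. \<nu> (a ^ n * b) \<le> D * \<sigma> ^ n"
proof -
  from decay obtain n1 where n1: "\<And>n. n1 \<le> n \<Longrightarrow> real n * \<nu> (a ^ n * b) \<le> L"
    by (auto simp: eventually_sequentially)
  define n0 where "n0 = Suc n1"
  have L0: "0 \<le> L" using n1[of n1] nonneg[of "a ^ n1 * b"] by (meson mult_nonneg_nonneg of_nat_0_le_iff order_refl order_trans)
  have decay0: "\<nu> (a ^ n * b) \<le> L / n" if "n0 \<le> n" for n
    using n1[of n] that by (simp add: n0_def field_simps)
  \<comment> \<open>Any \<open>q\<close> strictly between \<open>e L\<close> and \<open>1\<close> leaves room for the factor \<open>w > 1\<close>.\<close>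
  define q where "q = (1 + exp 1 * L) / 2"
  have "0 \<le> exp 1 * L" using L0 by simp
  then have q: "0 < q" "q < 1" "exp 1 * L < q" unfolding q_def using L by argo+
  obtain w where w: "1 < w" "exp 1 * w * L \<le> q"
  proof (cases "L = 0")
    case True then show ?thesis using q that[of 2] by simp
  next
    case False
    then have "0 < L" using L0 by simp
    then show ?thesis using q that[of "q / (exp 1 * L)"] by (simp add: field_simps)
  qed
  obtain v where v: "0 < v" "q ^ v \<le> 1 / 4"
  proof -
    have "(\<lambda>n. q ^ n) \<longlonglongrightarrow> 0" using q by (intro LIMSEQ_power_zero) auto
    then have "\<forall>\<^sub>F n in sequentially. q ^ n < 1 / 4" by (rule order_tendstoD) auto
    with eventually_gt_at_top[of 0] have "\<forall>\<^sub>F n in sequentially. 0 < n \<and> q ^ n < 1 / 4"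
      by eventually_elim auto
    then show ?thesis using that by (auto simp: eventually_sequentially intro: less_imp_le)
  qed
  define h where "h = max 2 n0 * v"
  have h: "0 < h" using v by (simp add: h_def)
  define C where "C = 1 / (1 - q)\<^sup>2 + \<nu> b"
  have C: "0 \<le> C" by (simp add: C_def nonneg)
  have "(\<lambda>u. real u * (1 / 2) ^ u) \<longlonglongrightarrow> 0"
    by (rule powser_times_n_limit_0) auto
  moreover have "0 < (w - 1) / v" using w v by simp
  ultimately have "\<forall>\<^sub>F u in sequentially. real u * (1 / 2) ^ u < (w - 1) / v"
    by (rule order_tendstoD)
  with eventually_gt_at_top[of 0]
  have ev: "\<forall>\<^sub>F u in sequentially. \<forall>s\<ge>h * u. \<nu> (a ^ s * b) \<le> C * (1 / 2) ^ u"
  proof eventually_elim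
    case (elim u)
    define K where "K = v * u - 1"
    define t :: nat where "t = 2 ^ u - 1"
    have K: "Suc K = v * u" using v elim by (simp add: K_def)
    have t: "Suc t = 2 ^ u" by (simp add: t_def)
    have "real v * real u \<le> (w - 1) * 2 ^ u"
      using elim v by (simp add: field_simps power_divide)
    moreover have "real (Suc K) = real v * real u" by (simp only: K of_nat_mult)
    ultimately have wK: "real K \<le> (w - 1) * real (Suc t)" unfolding t by simp
    show ?case
    proof (intro allI impI)
      fix s assume "h * u \<le> s"
      then have s: "max 2 n0 * Suc K \<le> s" unfolding K h_def by (simp add: mult.assoc)
      have "\<nu> (a ^ s * b) \<le> 1 / (1 - q)\<^sup>2 / Suc t + \<nu> b * Suc t * q ^ Suc K"
        using ab decay0 _ L0 _ wK w(2) q(2) s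
        by (rule gauge_expansion_estimate) (use w in \<open>auto simp: n0_def\<close>)
      also have "q ^ Suc K \<le> (1 / 4) ^ u"
        unfolding K power_mult using v q by (intro power_mono) auto
      then have "\<nu> b * Suc t * q ^ Suc K \<le> \<nu> b * Suc t * (1 / 4) ^ u"
        by (intro mult_left_mono) (auto simp: nonneg)
      also have "\<nu> b * Suc t * (1 / 4) ^ u = \<nu> b * (2 * (1 / 4)) ^ u"
        unfolding t power_mult_distrib by simp
      also have "1 / (1 - q)\<^sup>2 / Suc t = 1 / (1 - q)\<^sup>2 * (1 / 2) ^ u"
        unfolding t by (simp add: power_divide)
      finally show "\<nu> (a ^ s * b) \<le> C * (1 / 2) ^ u" by (simp add: C_def algebra_simps)
    qed
  qed
  \<comment> \<open>Passing from steps of length \<open>h\<close> to single steps.\<close>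
  define \<sigma> where "\<sigma> = root h (1 / 2)"
  have \<sigma>: "0 < \<sigma>" "\<sigma> < 1" "\<sigma> ^ h = 1 / 2"
    using h by (auto simp: \<sigma>_def real_root_lt_1_iff)
  have half: "(1 / 2) ^ (n div h) \<le> 2 * \<sigma> ^ n" for n
  proof -
    have "\<sigma> ^ (h * Suc (n div h)) \<le> \<sigma> ^ n"
      using \<sigma> dividend_less_times_div[OF h, of n] by (intro power_decreasing) auto
    then show ?thesis by (simp add: power_add power_mult \<sigma>)
  qed
  have "filterlim (\<lambda>n. n div h) sequentially sequentially"
    unfolding filterlim_at_top
  proof
    fix Z
    show "\<forall>\<^sub>F n in sequentially. Z \<le> n div h"
      using eventually_ge_at_top[of "Z * h"] by eventually_elim (simp add: less_eq_div_iff_mult_less_eq h)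
  qed
  from eventually_compose_filterlim[OF ev this]
  have "\<forall>\<^sub>F n in sequentially. norm (\<nu> (a ^ n * b) / \<sigma> ^ n) \<le> 2 * C"
  proof eventually_elim
    case (elim n)
    then have "\<nu> (a ^ n * b) \<le> C * (1 / 2) ^ (n div h)" by (simp add: mult.commute)
    also have "\<dots> \<le> C * (2 * \<sigma> ^ n)" by (intro mult_left_mono half C)
    finally show ?case using \<sigma> nonneg[of "a ^ n * b"] by (simp add: field_simps)
  qed
  then have "Bseq (\<lambda>n. \<nu> (a ^ n * b) / \<sigma> ^ n)" by (rule BfunI)
  then obtain D where D: "\<And>n. norm (\<nu> (a ^ n * b) / \<sigma> ^ n) \<le> D" by (auto simp: Bseq_def)
  have "\<nu> (a ^ n * b) \<le> D * \<sigma> ^ n" for n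
    using D[of n] \<sigma> nonneg[of "a ^ n * b"] by (simp add: field_simps)
  with \<sigma> show ?thesis using that by blast
qed

end

section \<open>From operators to polynomials and back\<close>

text \<open>The value \<open>p(T) x\<close>, by Horner's scheme.\<close>

definition op_poly :: "('a::real_normed_vector \<Rightarrow> 'a) \<Rightarrow> real poly \<Rightarrow> 'a \<Rightarrow> 'a" where
  "op_poly T p x = fold_coeffs (\<lambda>c y. c *\<^sub>R x + T y) p 0"

context
  fixes T :: "'a::real_normed_vector \<Rightarrow> 'a"
  assumes T: "bounded_linear T"
begin

interpretation T: bounded_linear T by (rule T)

lemma op_poly_0 [simp]: "op_poly T 0 x = 0"
  by (simp add: op_poly_def)

lemma op_poly_pCons [simp]: "op_poly T (pCons c p) x = c *\<^sub>R x + T (op_poly T p x)"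
  by (cases "c = 0 \<and> p = 0") (auto simp: op_poly_def T.zero)

lemma op_poly_add: "op_poly T (p + q) x = op_poly T p x + op_poly T q x"
  by (induction p q rule: poly_induct2) (simp_all add: T.add algebra_simps)

lemma op_poly_smult: "op_poly T (smult c p) x = c *\<^sub>R op_poly T p x"
  by (induction p) (simp_all add: T.scaleR algebra_simps)

lemma op_poly_mult: "op_poly T (p * q) x = op_poly T p (op_poly T q x)"
  by (induction p) (simp_all add: op_poly_add op_poly_smult)

lemma op_poly_X_power: "op_poly T ([:0, 1:] ^ n) x = (T ^^ n) x"
  by (induction n arbitrary: x) (simp_all add: op_poly_mult one_pCons T.zero funpow_swap1)

lemma bounded_linear_op_poly: "bounded_linear (op_poly T p)"
proof (induction p)
  case (pCons c p)
  have "bounded_linear (\<lambda>x. c *\<^sub>R x + T (op_poly T p x))"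
    by (intro bounded_linear_add bounded_linear_scaleR_right bounded_linear_compose[OF T] pCons.IH)
  then show ?case by (simp add: op_poly_pCons[abs_def])
qed (simp add: op_poly_0[abs_def] bounded_linear_zero)

lemma submultiplicative_gauge_onorm: "submultiplicative_gauge (\<lambda>p. onorm (op_poly T p))"
proof
  fix p q :: "real poly"
  note bl = bounded_linear_op_poly
  show "0 \<le> onorm (op_poly T p)" by (rule onorm_pos_le[OF bl])
  show "onorm (op_poly T 0) = 0" by (simp add: op_poly_0[abs_def] onorm_zero)
  show "onorm (op_poly T (p + q)) \<le> onorm (op_poly T p) + onorm (op_poly T q)"
    using onorm_triangle[OF bl bl, of p q] by (simp add: op_poly_add[abs_def])
  show "onorm (op_poly T (p * q)) \<le> onorm (op_poly T p) * onorm (op_poly T q)"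
    using onorm_compose[OF bl bl, of p q] by (simp add: op_poly_mult[abs_def] comp_def)
qed

text \<open>The ring elements are \<open>a = X\<close> and \<open>b = 1 - X\<close>, so that \<open>a\<^sup>n b\<close> acts as \<open>T\<^sup>n (I - T)\<close>, which
  is the difference in the hypothesis up to sign.\<close>

lemma limsup_imp_geometric_decay:
  assumes "limsup (\<lambda>n. ereal (real n * onorm (\<lambda>x. (T ^^ (n + 1)) x - (T ^^ n) x))) < ereal (1 / exp 1)"
  obtains D \<sigma> where "0 < \<sigma>" "\<sigma> < 1"
    "\<And>n. onorm (\<lambda>x. (T ^^ (n + 1)) x - (T ^^ n) x) \<le> D * \<sigma> ^ n"
proof -
  interpret submultiplicative_gauge "\<lambda>p. onorm (op_poly T p)"
    by (rule submultiplicative_gauge_onorm)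
  have eq: "onorm (op_poly T ([:0, 1:] ^ n * [:1, - 1:])) = onorm (\<lambda>x. (T ^^ (n + 1)) x - (T ^^ n) x)" for n
  proof -
    have "op_poly T ([:0, 1:] ^ n * [:1, - 1:]) x = - ((T ^^ (n + 1)) x - (T ^^ n) x)" for x
      unfolding mult.commute[of "[:0, 1:] ^ n"] op_poly_mult op_poly_X_power
      by (simp add: T.zero T.neg)
    then have "op_poly T ([:0, 1:] ^ n * [:1, - 1:]) = (\<lambda>x. - ((T ^^ (n + 1)) x - (T ^^ n) x))" by blast
    then show ?thesis by (simp only: onorm_neg)
  qed
  obtain L where L: "limsup (\<lambda>n. ereal (real n * onorm (\<lambda>x. (T ^^ (n + 1)) x - (T ^^ n) x))) < ereal L"
      "ereal L < ereal (1 / exp 1)"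
    using ereal_dense2[OF assms] by blast
  have "\<forall>\<^sub>F n in sequentially. real n * onorm (op_poly T ([:0, 1:] ^ n * [:1, - 1:])) \<le> L"
    using Limsup_lessD[OF L(1)] unfolding eq by eventually_elim (simp only: less_ereal.simps less_imp_le)
  moreover have "exp 1 * L < 1" using L(2) by (simp add: field_simps)
  moreover have "[:0, 1:] + [:1, - 1:] = (1 :: real poly)" by (simp add: one_pCons)
  ultimately show ?thesis
    using gauge_geometric_decay[of "[:0, 1:]" "[:1, - 1:]" L] that unfolding eq by blast
qed

end

section \<open>Convergence of the powers and the spectral radius\<close>

lemma bounded_linear_funpow:
  fixes T :: "'a::real_normed_vector \<Rightarrow> 'a"
  assumes "bounded_linear T"
  shows "bounded_linear (T ^^ n)"
  by (induction n) (simp_all add: bounded_linear_compose[OF assms] comp_def id_def bounded_linear_ident)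

text \<open>The geometric bound makes the telescoping series of the increments converge absolutely in
  the Banach space of bounded operators, with geometrically small tails.\<close>

lemma funpow_geometric_limit:
  fixes T :: "'a::banach \<Rightarrow> 'a"
  assumes T: "bounded_linear T" and \<sigma>: "0 \<le> \<sigma>" "\<sigma> < 1"
    and decay: "\<And>n. onorm (\<lambda>x. (T ^^ (n + 1)) x - (T ^^ n) x) \<le> D * \<sigma> ^ n"
  obtains P C where "bounded_linear P" "\<And>n. onorm (\<lambda>x. (T ^^ n) x - P x) \<le> C * \<sigma> ^ n"
proof -
  define B where "B n = Blinfun (T ^^ n)" for n
  have B: "blinfun_apply (B n) = T ^^ n" for n
    by (simp add: B_def bounded_linear_Blinfun_apply bounded_linear_funpow T)
  define d where "d n = B (Suc n) - B n" for n
  have d: "norm (d n) \<le> D * \<sigma> ^ n" for n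
    using decay[of n] by (simp add: d_def norm_blinfun.rep_eq minus_blinfun.rep_eq B)
  have geo: "summable (\<lambda>i. D * \<sigma> ^ n * \<sigma> ^ i)" for n
    using \<sigma> by (intro summable_mult summable_geometric) auto
  have nd: "summable (\<lambda>i. norm (d (i + n)))" for n
    by (rule summable_comparison_test'[OF geo[of n], of 0])
      (use d[of "i + n" for i] in \<open>simp add: power_add mult_ac\<close>)
  have sd: "summable d" using nd[of 0] summable_norm_cancel[of d] by simp
  define Q where "Q = B 0 + suminf d"
  have "norm (B n - Q) \<le> D / (1 - \<sigma>) * \<sigma> ^ n" for n
  proof -
    have "B n = B 0 + (\<Sum>i<n. d i)"
      by (simp add: d_def sum_lessThan_telescope)
    then have "B n - Q = - (\<Sum>i. d (i + n))"
      using suminf_split_initial_segment[OF sd, of n] by (simp add: Q_def)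
    then have "norm (B n - Q) \<le> (\<Sum>i. norm (d (i + n)))"
      using summable_norm[OF nd[of n]] by simp
    also have "\<dots> \<le> (\<Sum>i. D * \<sigma> ^ n * \<sigma> ^ i)"
      by (intro suminf_le nd geo) (use d[of "i + n" for i] in \<open>simp add: power_add mult_ac\<close>)
    also have "\<dots> = D / (1 - \<sigma>) * \<sigma> ^ n"
      using \<sigma> by (simp add: suminf_mult suminf_geometric)
    finally show ?thesis .
  qed
  then have "onorm (\<lambda>x. (T ^^ n) x - blinfun_apply Q x) \<le> D / (1 - \<sigma>) * \<sigma> ^ n" for n
    by (simp add: norm_blinfun.rep_eq minus_blinfun.rep_eq B)
  then show ?thesis using that blinfun.bounded_linear_right by blast
qed

lemma bounded_linear_scaleC: "bounded_linear (\<lambda>x::'a::complex_normed_vector. c *\<^sub>C x)"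
  by (rule bounded_linear_intro[of _ "cmod c"])
    (simp_all add: scaleC_add_right scaleR_scaleC scaleC_scaleC norm_scaleC mult.commute)

lemma funpow_scaleC:
  fixes T :: "'a::complex_normed_vector \<Rightarrow> 'a"
  assumes "\<And>c x. T (c *\<^sub>C x) = c *\<^sub>C T x"
  shows "(T ^^ n) (c *\<^sub>C x) = c *\<^sub>C (T ^^ n) x"
  by (induction n) (simp_all add: assms)

text \<open>The Neumann series for the inverse of \<open>c - T\<close> is summed vector by vector; as \<open>N\<close> is closed,
  its value stays in \<open>N\<close>.\<close>

lemma invertible_on_if_geometric_orbits:
  fixes T :: "'a::complex_banach \<Rightarrow> 'a"
  assumes T: "bounded_clinear T"
    and N: "csubspace N" "closed N" "T ` N \<subseteq> N"
    and orbit: "\<And>y n. y \<in> N \<Longrightarrow> norm ((T ^^ n) y) \<le> C * \<sigma> ^ n * norm y"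
    and \<sigma>: "0 \<le> \<sigma>" "\<sigma> < cmod c"
  shows "invertible_on N (\<lambda>x. c *\<^sub>C x - T x)"
proof -
  interpret T: bounded_linear T using T by (simp add: bounded_clinear_def)
  have Tc: "T (d *\<^sub>C x) = d *\<^sub>C T x" for d x using T by (simp add: bounded_clinear_def)
  interpret Tn: bounded_linear "T ^^ n" for n by (rule bounded_linear_funpow[OF T.bounded_linear_axioms])
  interpret sc: bounded_linear "\<lambda>x::'a. d *\<^sub>C x" for d by (rule bounded_linear_scaleC)
  have sub: "subspace N" and scN: "y \<in> N \<Longrightarrow> d *\<^sub>C y \<in> N" for d y
    using N(1) by (auto simp: csubspace_def)
  have TN: "y \<in> N \<Longrightarrow> (T ^^ n) y \<in> N" for n y
    using N(3) by (induction n) auto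
  have c0: "c \<noteq> 0" using \<sigma> by auto
  define u where "u n y = inverse c ^ Suc n *\<^sub>C (T ^^ n) y" for n y
  define g where "g y = (\<Sum>n. u n y)" for y
  define r where "r = \<sigma> / cmod c"
  have r: "0 \<le> r" "r < 1" using \<sigma> by (auto simp: r_def divide_simps)
  have nu: "norm (u n y) \<le> C / cmod c * norm y * r ^ n" if "y \<in> N" for n y
  proof -
    have "norm (u n y) = norm ((T ^^ n) y) / cmod c ^ Suc n"
      by (simp add: u_def norm_scaleC norm_power norm_inverse norm_mult divide_inverse mult_ac power_inverse)
    also have "\<dots> \<le> C * \<sigma> ^ n * norm y / cmod c ^ Suc n"
      using orbit[OF that] by (intro divide_right_mono) auto
    also have "\<dots> = C / cmod c * norm y * r ^ n"
      by (simp add: r_def power_divide)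
    finally show ?thesis .
  qed
  have geo: "summable (\<lambda>n. C / cmod c * norm y * r ^ n)" for y :: 'a
    using r by (intro summable_mult summable_geometric) auto
  have snu: "summable (\<lambda>n. norm (u n y))" if "y \<in> N" for y
    by (rule summable_comparison_test'[OF geo[of y], of 0]) (use nu that in auto)
  then have su: "summable (\<lambda>n. u n y)" if "y \<in> N" for y
    using that by (blast intro: summable_norm_cancel)
  have g_N: "g y \<in> N" if y: "y \<in> N" for y
  proof (rule closed_sequentially[OF N(2)])
    show "(\<lambda>n. \<Sum>i<n. u i y) \<longlonglongrightarrow> g y" unfolding g_def by (rule summable_LIMSEQ[OF su[OF y]])
    show "(\<Sum>i<n. u i y) \<in> N" for n
      unfolding u_def by (intro subspace_sum[OF sub] scN TN y)
  qed
  have "bounded_clinear_on N g"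
    unfolding bounded_clinear_on_def
  proof (intro conjI ballI allI exI)
    show "g \<in> N \<rightarrow> N" using g_N by auto
    show "g (x + y) = g x + g y" if "x \<in> N" "y \<in> N" for x y
      using suminf_add[OF su su, OF that] by (simp add: g_def u_def Tn.add scaleC_add_right)
    show "g (d *\<^sub>C y) = d *\<^sub>C g y" if "y \<in> N" for d y
      using sc.suminf[OF su[OF that], of d]
      by (simp add: g_def u_def funpow_scaleC[of T, OF Tc] scaleC_scaleC mult.commute)
    show "norm (g y) \<le> C / cmod c / (1 - r) * norm y" if "y \<in> N" for y
    proof -
      have "norm (g y) \<le> (\<Sum>n. norm (u n y))"
        unfolding g_def by (rule summable_norm[OF snu[OF that]])
      also have "\<dots> \<le> (\<Sum>n. C / cmod c * norm y * r ^ n)"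
        by (intro suminf_le nu that snu geo)
      also have "\<dots> = C / cmod c / (1 - r) * norm y"
        using r by (subst suminf_mult) (auto simp: suminf_geometric intro: summable_geometric)
      finally show ?thesis .
    qed
  qed
  moreover have "g (c *\<^sub>C y - T y) = y" "c *\<^sub>C g y - T (g y) = y" if y: "y \<in> N" for y
  proof -
    define v where "v n = c *\<^sub>C u n y" for n
    have Tu: "T (u n y) = v (Suc n)" for n
      using c0 by (simp add: v_def u_def Tc scaleC_scaleC field_simps)
    have "(\<lambda>n. c *\<^sub>C u n y) \<longlonglongrightarrow> c *\<^sub>C 0"
      by (intro sc.tendsto summable_LIMSEQ_zero su y)
    then have "v \<longlonglongrightarrow> 0" by (simp add: v_def[abs_def] sc.zero)
    then have "(\<lambda>n. v n - v (Suc n)) sums (v 0 - 0)" by (rule telescope_sums')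
    moreover have "v 0 = y"
      using c0 scaleR_scaleC[of 1 y] by (simp add: v_def u_def scaleC_scaleC)
    ultimately have tel: "(\<Sum>n. v n - v (Suc n)) = y" by (simp add: sums_iff)
    have "u n (c *\<^sub>C y - T y) = v n - v (Suc n)" for n
    proof -
      have "u n (T y) = T (u n y)" by (simp add: u_def Tc funpow_swap1)
      then show ?thesis
        by (simp add: Tu[symmetric]) (simp add: v_def u_def Tn.diff sc.diff funpow_scaleC[of T, OF Tc] scaleC_scaleC mult.commute)
    qed
    then show "g (c *\<^sub>C y - T y) = y" by (simp add: g_def tel)
    have "c *\<^sub>C g y - T (g y) = (\<Sum>n. c *\<^sub>C u n y) - (\<Sum>n. T (u n y))"
      by (simp add: g_def sc.suminf T.suminf su y)
    also have "\<dots> = (\<Sum>n. c *\<^sub>C u n y - T (u n y))"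
      by (intro suminf_diff sc.summable T.summable su y)
    finally show "c *\<^sub>C g y - T (g y) = y" by (simp add: Tu tel flip: v_def)
  qed
  ultimately show ?thesis by (auto simp: invertible_on_def)
qed

lemma spectral_radius_on_le_if_geometric_orbits:
  fixes T :: "'a::complex_banach \<Rightarrow> 'a"
  assumes "bounded_clinear T" "csubspace N" "closed N" "T ` N \<subseteq> N"
    and "\<And>y n. y \<in> N \<Longrightarrow> norm ((T ^^ n) y) \<le> C * \<sigma> ^ n * norm y" and "0 \<le> \<sigma>"
  shows "spectral_radius_on N T \<le> ennreal \<sigma>"
  unfolding spectral_radius_on_def
proof (rule SUP_least)
  fix c assume "c \<in> spectrum_on N T"
  then have "\<not> \<sigma> < cmod c"
    using invertible_on_if_geometric_orbits[OF assms] by (auto simp: spectrum_on_def)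
  then show "ennreal (cmod c) \<le> ennreal \<sigma>" by (simp add: ennreal_leI)
qed

theorem theorem3p1:
  fixes T :: "'a::complex_banach \<Rightarrow> 'a"
  assumes "bounded_clinear T"
    and "limsup (\<lambda>n. ereal (real n * onorm (\<lambda>x. (T ^^ (n + 1)) x - (T ^^ n) x))) < ereal (1 / exp 1)"
  shows "(\<exists>M N. csubspace M \<and> closed M \<and> T ` M \<subseteq> M \<and>
                csubspace N \<and> closed N \<and> T ` N \<subseteq> N \<and>
                direct_sum_decomposition M N \<and>
                (\<forall>x\<in>M. T x = x) \<and>
                spectral_radius_on N T < 1) \<and>
         (\<exists>P. bounded_projection P \<and>
              (\<lambda>n. onorm (\<lambda>x. (T ^^ n) x - P x)) \<longlonglongrightarrow> 0)"
proof -
  have T: "bounded_linear T" and Tc: "T (c *\<^sub>C x) = c *\<^sub>C T x" for c x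
    using assms(1) by (auto simp: bounded_clinear_def)
  interpret T: bounded_linear T by (rule T)
  interpret sc: bounded_linear "\<lambda>x::'a. d *\<^sub>C x" for d by (rule bounded_linear_scaleC)
  obtain D \<sigma> where \<sigma>: "0 < \<sigma>" "\<sigma> < 1"
    and D: "\<And>n. onorm (\<lambda>x. (T ^^ (n + 1)) x - (T ^^ n) x) \<le> D * \<sigma> ^ n"
    using limsup_imp_geometric_decay[OF T assms(2)] by blast
  obtain P C where P: "bounded_linear P" and C: "\<And>n. onorm (\<lambda>x. (T ^^ n) x - P x) \<le> C * \<sigma> ^ n"
    using funpow_geometric_limit[OF T less_imp_le[OF \<sigma>(1)] \<sigma>(2) D] by blast
  interpret P: bounded_linear P by (rule P)
  have bl: "bounded_linear (\<lambda>x. (T ^^ n) x - P x)" for n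
    by (intro bounded_linear_sub bounded_linear_funpow T P)
  have C0: "(\<lambda>n. C * \<sigma> ^ n) \<longlonglongrightarrow> 0"
    using \<sigma> by (intro tendsto_mult_right_zero LIMSEQ_power_zero) auto
  have unif: "(\<lambda>n. onorm (\<lambda>x. (T ^^ n) x - P x)) \<longlonglongrightarrow> 0"
    by (rule tendsto_sandwich[OF _ _ tendsto_const C0]) (use onorm_pos_le[OF bl] C in auto)
  have near: "norm ((T ^^ n) x - P x) \<le> C * \<sigma> ^ n * norm x" for n x
    using onorm[OF bl, of n x] C[of n] by (meson mult_right_mono norm_ge_zero order_trans)
  have lim: "(\<lambda>n. (T ^^ n) x) \<longlonglongrightarrow> P x" for x
  proof -
    have "(\<lambda>n. norm ((T ^^ n) x - P x)) \<longlonglongrightarrow> 0"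
      by (rule tendsto_sandwich[OF _ _ tendsto_const tendsto_mult_left_zero[OF C0, of "norm x"]]) (use near in auto)
    then show ?thesis by (rule LIM_zero_cancel[OF tendsto_norm_zero_cancel])
  qed
  have PT: "P (T x) = P x" for x
    using LIMSEQ_unique[OF lim[of "T x"]] LIMSEQ_Suc[OF lim[of x]] by (simp add: funpow_swap1)
  have TP: "T (P x) = P x" for x
    using LIMSEQ_unique[OF T.tendsto[OF lim[of x]]] LIMSEQ_Suc[OF lim[of x]] by simp
  \<comment> \<open>Together with \<open>TP\<close> this identifies the range of \<open>P\<close> with the fixed space of \<open>T\<close>.\<close>
  have fix_P: "P x = x" if "T x = x" for x
  proof -
    have "(T ^^ n) x = x" for n using that by (induction n) auto
    then show ?thesis using lim[of x] by (simp add: LIMSEQ_const_iff)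
  qed
  have PP: "P (P x) = P x" for x by (rule fix_P[OF TP])
  have Pc: "P (c *\<^sub>C x) = c *\<^sub>C P x" for c x
    using LIMSEQ_unique[OF lim[of "c *\<^sub>C x"]] sc.tendsto[OF lim[of x], of c]
    by (simp add: funpow_scaleC[of T, OF Tc])
  define M where "M = {x. T x = x}"
  define N where "N = {x. P x = 0}"
  have M: "csubspace M" "closed M" "T ` M \<subseteq> M"
    by (auto simp: M_def csubspace_def subspace_def T.zero T.add T.scaleR Tc
        intro!: closed_Collect_eq T.continuous_on continuous_intros)
  have N: "csubspace N" "closed N" "T ` N \<subseteq> N"
    by (auto simp: N_def csubspace_def subspace_def P.zero P.add P.scaleR Pc PT sc.zero
        intro!: closed_Collect_eq P.continuous_on continuous_intros)
  have "direct_sum_decomposition M N"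
    unfolding direct_sum_decomposition_def
  proof (intro conjI allI)
    show "M \<inter> N = {0}" using fix_P by (auto simp: M_def N_def T.zero P.zero)
    fix x
    have "P x \<in> M" "x - P x \<in> N" "x = P x + (x - P x)"
      by (auto simp: M_def N_def TP PP P.diff)
    then show "\<exists>m\<in>M. \<exists>n\<in>N. x = m + n" by blast
  qed
  moreover have "spectral_radius_on N T < 1"
  proof -
    have "norm ((T ^^ n) y) \<le> C * \<sigma> ^ n * norm y" if "y \<in> N" for y n
      using near[of n y] that by (simp add: N_def)
    then have "spectral_radius_on N T \<le> ennreal \<sigma>"
      using \<sigma> by (intro spectral_radius_on_le_if_geometric_orbits[OF assms(1) N]) auto
    also have "\<dots> < 1" using \<sigma> by (simp add: ennreal_less_one_iff)
    finally show ?thesis .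
  qed
  moreover have "bounded_projection P"
    using P Pc PP by (auto simp: bounded_projection_def bounded_clinear_def)
  moreover have "\<forall>x\<in>M. T x = x" by (simp add: M_def)
  ultimately show ?thesis using M N unif by blast
qed

end
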